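(* For primes $p\equiv 3\pmod 4$, the mixing time $\tau_p$ of the random walk on circles defined below satisfies $\tau_p=O(p)$ as $p\to\infty$.
   Context: For $K\in\mathbb{F}_p$ let $C_K=\{(u,v)\in\mathbb{F}_p^2:u^2+v^2=K\}$, and for $i,j,k\in\mathbb{F}_p$ let $N_{ij}^k=\#\{(a,b)\in C_i\times C_j: a+b\in C_k\}$ and $n_{ij}^k=N_{ij}^k/(|C_i||C_j|)$. Consider the Markov chain on the $p$ states $c_0,\dots,c_{p-1}$ with kernel $A_1(c_i,c_j)=n_{i1}^j$ (the quadrance of a walk taking uniform steps from $C_1$). Its stationary distribution is $\pi(c_0)=1/p^2$, $\pi(c_j)=(p+1)/p^2$ for $j\ne0$. The total variation distance is $d_{TV}(\mu,\nu)=\frac12\sum_x|\mu(x)-\nu(x)|$, and $\tau_p=\max_{i}\min\{t: d_{TV}(A_1^t(c_i,\cdot),\pi)\le 1/(2e)\}$. *)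

theory Defs
  imports
    Complex_Main
    "HOL-Computational_Algebra.Primes"
    "HOL-Number_Theory.Cong"
    "HOL-Library.Extended_Nat"
    "HOL-Library.Extended_Real"
    "Jordan_Normal_Form.Matrix"
begin

text \<open>
  Since the prime \<open>p\<close> varies inside the statement, the field with \<open>p\<close> elements is represented by
  the residues \<open>{..<p}\<close> with arithmetic modulo \<open>p\<close>; the state \<open>c\<^sub>i\<close> is the index \<open>i < p\<close>.
\<close>

definition circle :: "nat \<Rightarrow> nat \<Rightarrow> (nat \<times> nat) set" where
  "circle p K = {(u, v). u < p \<and> v < p \<and> [u\<^sup>2 + v\<^sup>2 = K] (mod p)}"

definition add_pt :: "nat \<Rightarrow> nat \<times> nat \<Rightarrow> nat \<times> nat \<Rightarrow> nat \<times> nat" where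
  "add_pt p a b = ((fst a + fst b) mod p, (snd a + snd b) mod p)"

definition circle_N :: "nat \<Rightarrow> nat \<Rightarrow> nat \<Rightarrow> nat \<Rightarrow> nat" where
  "circle_N p i j k = card {(a, b) \<in> circle p i \<times> circle p j. add_pt p a b \<in> circle p k}"

definition circle_n :: "nat \<Rightarrow> nat \<Rightarrow> nat \<Rightarrow> nat \<Rightarrow> real" where
  "circle_n p i j k =
     real (circle_N p i j k) / (real (card (circle p i)) * real (card (circle p j)))"

definition circle_kernel :: "nat \<Rightarrow> real mat" where
  "circle_kernel p = mat p p (\<lambda>(i, j). circle_n p i 1 j)"

definition circle_stationary :: "nat \<Rightarrow> nat \<Rightarrow> real" where
  "circle_stationary p j = (if j = 0 then 1 / real p ^ 2 else (real p + 1) / real p ^ 2)"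

definition tv_dist :: "'s set \<Rightarrow> ('s \<Rightarrow> real) \<Rightarrow> ('s \<Rightarrow> real) \<Rightarrow> real" where
  "tv_dist S \<mu> \<nu> = (1 / 2) * (\<Sum>x\<in>S. \<bar>\<mu> x - \<nu> x\<bar>)"

text \<open>
  The minimum over \<open>t\<close> is taken as an infimum of extended naturals, so that a starting state
  from which the threshold is never reached contributes \<open>\<infinity>\<close> instead of an arbitrary number.
\<close>

definition circle_mixing_time :: "nat \<Rightarrow> enat" where
  "circle_mixing_time p =
     (MAX i\<in>{..<p}. INF t\<in>{t. tv_dist {..<p} (\<lambda>j. (circle_kernel p ^\<^sub>m t) $$ (i, j))
                                  (circle_stationary p) \<le> 1 / (2 * exp 1)}. enat t)"

end

theory Submission
  imports Defs "HOL-Number_Theory.Residues"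
begin

text \<open>
  The kernel acts on functions of the quadrance by averaging over the unit circle \<open>C\<^sub>1\<close>, which has
  \<open>p + 1\<close> points. For \<open>a \<noteq> 0\<close> the map sending \<open>b \<in> C\<^sub>1\<close> to the quadrance of \<open>a + b\<close> is at most
  two-to-one, so it takes more than \<open>p / 2\<close> values. Two walks at nonzero points can therefore always
  be coupled to reach the same state with probability \<open>1 / (p + 1)\<close> in one step. State \<open>0\<close> moves to
  state \<open>1\<close> surely and is itself entered with probability at most \<open>1 / (p + 1)\<close>, so two steps shrink
  the oscillation of any function by the factor \<open>1 - p / (p + 1)\<^sup>2 \<le> exp (-1 / (2 p))\<close>, and \<open>8 p\<close>
  steps suffice.
\<close>

section \<open>Counting and comparing finite sums\<close>

text \<open>Pigeonhole: two disjoint images would not fit into \<open>U\<close>. This serves both to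
  write residues as sums of two squares and to make two walks meet.\<close>

lemma images_intersect:
  assumes "finite U" "f ` A \<subseteq> U" "g ` B \<subseteq> U" "card U < card (f ` A) + card (g ` B)"
  obtains a b where "a \<in> A" "b \<in> B" "f a = g b"
proof -
  have "f ` A \<inter> g ` B \<noteq> {}"
  proof
    assume "f ` A \<inter> g ` B = {}"
    then have "card (f ` A \<union> g ` B) = card (f ` A) + card (g ` B)"
      using assms by (intro card_Un_disjoint) (auto intro: finite_subset)
    moreover have "card (f ` A \<union> g ` B) \<le> card U"
      using assms by (intro card_mono) auto
    ultimately show False using assms by linarith
  qed
  then show thesis using that by auto
qed

lemma card_le_mult_card_image:
  assumes "finite A" "\<And>y. y \<in> f ` A \<Longrightarrow> card {x \<in> A. f x = y} \<le> m"
  shows "card A \<le> m * card (f ` A)"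
proof -
  have "card A = (\<Sum>y\<in>f ` A. card {x \<in> A. f x = y})"
    using sum.image_gen[OF assms(1), of "\<lambda>_. 1::nat" f] by simp
  also have "\<dots> \<le> (\<Sum>y\<in>f ` A. m)"
    using assms by (intro sum_mono) auto
  finally show ?thesis by (simp add: mult.commute)
qed

text \<open>An arbitrary bijection pairs the summands, and each pair differs by at most
  \<open>D\<close>. This is a coupling argument expressed through sums.\<close>

lemma abs_diff_sum_le:
  fixes f :: "'a \<Rightarrow> real" and g :: "'b \<Rightarrow> real"
  assumes "finite A" "finite B" "card A = card B"
    and "\<And>a b. a \<in> A \<Longrightarrow> b \<in> B \<Longrightarrow> \<bar>f a - g b\<bar> \<le> D"
  shows "\<bar>(\<Sum>a\<in>A. f a) - (\<Sum>b\<in>B. g b)\<bar> \<le> real (card A) * D"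
proof -
  obtain h where h: "bij_betw h A B"
    using assms(1-3) finite_same_card_bij by blast
  have "(\<Sum>b\<in>B. g b) = (\<Sum>a\<in>A. g (h a))"
    using sum.reindex_bij_betw[OF h, of g] by simp
  then have "\<bar>(\<Sum>a\<in>A. f a) - (\<Sum>b\<in>B. g b)\<bar> = \<bar>\<Sum>a\<in>A. f a - g (h a)\<bar>"
    by (simp add: sum_subtractf)
  also have "\<dots> \<le> (\<Sum>a\<in>A. \<bar>f a - g (h a)\<bar>)" by (rule sum_abs)
  also have "\<dots> \<le> (\<Sum>a\<in>A. D)"
    using assms h by (intro sum_mono) (auto simp: bij_betw_def)
  finally show ?thesis by simp
qed

lemma abs_sum_le_card_mult:
  fixes f :: "'a \<Rightarrow> real"
  assumes "\<And>a. a \<in> A \<Longrightarrow> \<bar>f a\<bar> \<le> D"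
  shows "\<bar>\<Sum>a\<in>A. f a\<bar> \<le> real (card A) * D"
proof -
  have "\<bar>\<Sum>a\<in>A. f a\<bar> \<le> (\<Sum>a\<in>A. \<bar>f a\<bar>)" by (rule sum_abs)
  also have "\<dots> \<le> real (card A) * D"
    using assms sum_bounded_above[of A "\<lambda>a. \<bar>f a\<bar>" D] by simp
  finally show ?thesis .
qed

section \<open>Total variation distance and oscillation\<close>

text \<open>The Markov operator on functions: for a stochastic \<open>A\<close>, the expectation of
  \<open>f\<close> after one step from \<open>i\<close>. Working on functions rather than on
  distributions lets oscillation be the contracted quantity.\<close>

definition mat_app :: "real mat \<Rightarrow> (nat \<Rightarrow> real) \<Rightarrow> nat \<Rightarrow> real" where
  "mat_app A f i = (\<Sum>j<dim_col A. A $$ (i, j) * f j)"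

text \<open>The last step of the walk is the one that acts on \<open>f\<close> first, so inductions
  on \<open>t\<close> have to let \<open>f\<close> vary.\<close>

lemma mat_app_pow_Suc:
  assumes "A \<in> carrier_mat n n" "i < n"
  shows "mat_app (A ^\<^sub>m Suc t) f i = mat_app (A ^\<^sub>m t) (mat_app A f) i"
proof -
  have c: "A ^\<^sub>m t \<in> carrier_mat n n" using assms by simp
  have "mat_app (A ^\<^sub>m Suc t) f i = (\<Sum>j<n. (\<Sum>k<n. (A ^\<^sub>m t) $$ (i, k) * A $$ (k, j)) * f j)"
    using assms c by (auto simp: mat_app_def scalar_prod_def lessThan_atLeast0 intro!: sum.cong)
  also have "\<dots> = (\<Sum>j<n. \<Sum>k<n. (A ^\<^sub>m t) $$ (i, k) * (A $$ (k, j) * f j))"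
    by (simp add: sum_distrib_right mult.assoc)
  also have "\<dots> = (\<Sum>k<n. \<Sum>j<n. (A ^\<^sub>m t) $$ (i, k) * (A $$ (k, j) * f j))"
    by (rule sum.swap)
  also have "\<dots> = mat_app (A ^\<^sub>m t) (mat_app A f) i"
    using assms c by (simp add: mat_app_def sum_distrib_left)
  finally show ?thesis .
qed

lemma mat_app_pow_0:
  assumes "A \<in> carrier_mat n n" "i < n"
  shows "mat_app (A ^\<^sub>m 0) f i = f i"
proof -
  have "mat_app (A ^\<^sub>m 0) f i = (\<Sum>j<n. (if i = j then 1 else 0) * f j)"
    using assms by (simp add: mat_app_def)
  also have "\<dots> = (\<Sum>j<n. if i = j then f j else 0)"
    by (intro sum.cong) auto
  also have "\<dots> = f i" using assms(2) by simp
  finally show ?thesis .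
qed

lemma stationary_pow:
  assumes A: "A \<in> carrier_mat n n"
    and st: "\<And>f. (\<Sum>i<n. \<pi> i * mat_app A f i) = (\<Sum>i<n. \<pi> i * f i)"
  shows "(\<Sum>i<n. \<pi> i * mat_app (A ^\<^sub>m t) f i) = (\<Sum>i<n. \<pi> i * f i)"
proof (induction t arbitrary: f)
  case 0
  then show ?case using mat_app_pow_0[OF A] by (auto intro!: sum.cong)
next
  case (Suc t)
  have "(\<Sum>i<n. \<pi> i * mat_app (A ^\<^sub>m Suc t) f i)
      = (\<Sum>i<n. \<pi> i * mat_app (A ^\<^sub>m t) (mat_app A f) i)"
    using mat_app_pow_Suc[OF A] by (intro sum.cong) auto
  then show ?case by (simp only: Suc st)
qed

text \<open>Each block of two steps replaces \<open>f\<close> by its double average and the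
  oscillation bound \<open>D\<close> by \<open>r * D\<close>; hence both are generalised in the
  induction.\<close>

lemma two_step_contraction_pow:
  assumes A: "A \<in> carrier_mat n n"
    and contr: "\<And>f D i j. \<lbrakk>\<And>i j. i < n \<Longrightarrow> j < n \<Longrightarrow> \<bar>f i - f j\<bar> \<le> D; i < n; j < n\<rbrakk>
      \<Longrightarrow> \<bar>mat_app A (mat_app A f) i - mat_app A (mat_app A f) j\<bar> \<le> r * D"
    and f: "\<And>i j. i < n \<Longrightarrow> j < n \<Longrightarrow> \<bar>f i - f j\<bar> \<le> D" and "i < n" "j < n"
  shows "\<bar>mat_app (A ^\<^sub>m (2 * s)) f i - mat_app (A ^\<^sub>m (2 * s)) f j\<bar> \<le> r ^ s * D"
  using f
proof (induction s arbitrary: f D)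
  case 0
  then show ?case using mat_app_pow_0[OF A] assms(4,5) by simp
next
  case (Suc s)
  have e: "mat_app (A ^\<^sub>m (2 * Suc s)) f k = mat_app (A ^\<^sub>m (2 * s)) (mat_app A (mat_app A f)) k"
    if "k < n" for k
    using that mat_app_pow_Suc[OF A that, of "Suc (2 * s)"] mat_app_pow_Suc[OF A that, of "2 * s"]
    by simp
  have "\<bar>mat_app (A ^\<^sub>m (2 * s)) (mat_app A (mat_app A f)) i
       - mat_app (A ^\<^sub>m (2 * s)) (mat_app A (mat_app A f)) j\<bar> \<le> r ^ s * (r * D)"
    by (rule Suc.IH, rule contr[OF Suc.prems])
  then show ?case using e assms(4,5) by (simp add: mult.assoc mult.left_commute)
qed

text \<open>By duality the l1 distance is the difference of two expectations of a sign function.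
  Stationarity rewrites the expectation under \<open>\<pi>\<close> as a \<open>\<pi>\<close>-average
  of the values of \<open>mat_app\<close> for the power, so only their oscillation remains.\<close>

lemma tv_dist_le_two_step_contraction:
  assumes A: "A \<in> carrier_mat n n"
    and st: "\<And>f. (\<Sum>i<n. \<pi> i * mat_app A f i) = (\<Sum>i<n. \<pi> i * f i)"
    and \<pi>: "\<And>i. i < n \<Longrightarrow> 0 \<le> \<pi> i" "(\<Sum>i<n. \<pi> i) = 1"
    and contr: "\<And>f D i j. \<lbrakk>\<And>i j. i < n \<Longrightarrow> j < n \<Longrightarrow> \<bar>f i - f j\<bar> \<le> D; i < n; j < n\<rbrakk>
      \<Longrightarrow> \<bar>mat_app A (mat_app A f) i - mat_app A (mat_app A f) j\<bar> \<le> r * D"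
    and i: "i < n"
  shows "tv_dist {..<n} (\<lambda>j. (A ^\<^sub>m (2 * s)) $$ (i, j)) \<pi> \<le> r ^ s"
proof -
  let ?B = "A ^\<^sub>m (2 * s)"
  \<comment> \<open>The test function attaining the l1 distance. Its oscillation is at most 2, which
    cancels the factor 1/2 in \<open>tv_dist\<close>.\<close>
  define f where "f j = sgn (?B $$ (i, j) - \<pi> j)" for j
  have f: "\<bar>f k - f l\<bar> \<le> 2" for k l by (auto simp: f_def sgn_if)
  have B: "?B \<in> carrier_mat n n" using A by simp
  have "(\<Sum>j<n. \<bar>?B $$ (i, j) - \<pi> j\<bar>) = (\<Sum>j<n. ?B $$ (i, j) * f j - \<pi> j * f j)"
    by (intro sum.cong) (auto simp: f_def abs_sgn left_diff_distrib)
  also have "\<dots> = mat_app ?B f i - (\<Sum>j<n. \<pi> j * f j)"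
    by (simp only: mat_app_def carrier_matD(2)[OF B] sum_subtractf)
  also have "(\<Sum>j<n. \<pi> j * f j) = (\<Sum>j<n. \<pi> j * mat_app ?B f j)"
    by (rule stationary_pow[OF A st, symmetric])
  also have "mat_app ?B f i - \<dots> = (\<Sum>j<n. \<pi> j * (mat_app ?B f i - mat_app ?B f j))"
    using \<pi>(2) by (simp add: right_diff_distrib sum_subtractf flip: sum_distrib_right)
  also have "\<dots> \<le> (\<Sum>j<n. \<pi> j * (r ^ s * 2))"
  proof (intro sum_mono mult_left_mono)
    fix j assume "j \<in> {..<n}"
    then have j: "j < n" by simp
    have "\<bar>mat_app ?B f i - mat_app ?B f j\<bar> \<le> r ^ s * 2"
      by (rule two_step_contraction_pow[OF A]; (fact contr | rule f | fact i | fact j))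
    then show "mat_app ?B f i - mat_app ?B f j \<le> r ^ s * 2" by linarith
  qed (use \<pi> in auto)
  also have "\<dots> = r ^ s * 2" using \<pi>(2) by (simp flip: sum_distrib_right)
  finally show ?thesis by (simp add: tv_dist_def)
qed

section \<open>Circles over a prime field in which \<open>-1\<close> is not a square\<close>

lemma int_dvd_small_eq_0:
  fixes x :: int
  assumes "int p dvd x" "\<bar>x\<bar> < int p"
  shows "x = 0"
  using assms zdvd_imp_le[of "int p" "\<bar>x\<bar>"] by force

text \<open>If \<open>u\<close> and \<open>v\<close> were units with
  \<open>u\<^sup>2 = - v\<^sup>2\<close>, raising to the power \<open>(p - 1) / 2\<close> and
  applying Fermat's theorem would give \<open>1 = - 1\<close>.\<close>

lemma prime_3_mod_4_anisotropic:
  fixes p u v :: nat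
  assumes p: "prime p" "[p = 3] (mod 4)" and d: "p dvd u\<^sup>2 + v\<^sup>2"
  shows "p dvd u" "p dvd v"
proof -
  have "p dvd u \<and> p dvd v"
  proof (rule ccontr)
    assume "\<not> (p dvd u \<and> p dvd v)"
    moreover have "p dvd u \<longleftrightarrow> p dvd v"
      using d p(1) by (metis dvd_add_right_iff dvd_add_left_iff prime_dvd_power_iff pos2)
    ultimately have n: "\<not> p dvd u" "\<not> p dvd v" by auto
    have "p mod 4 = 3" using p(2) by (simp add: cong_def)
    then obtain k where k: "p = 4 * k + 3" by (metis mult_div_mod_eq)
    have "[u ^ (p - 1) = 1] (mod p)" "[v ^ (p - 1) = 1] (mod p)"
      using fermat_theorem[OF p(1)] n by auto
    then have f: "[int u ^ (p - 1) = 1] (mod int p)" "[int v ^ (p - 1) = 1] (mod int p)"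
      by (metis cong_int_iff of_nat_1 of_nat_power)+
    have "int p dvd (int u)\<^sup>2 + (int v)\<^sup>2" using d by (metis of_nat_add of_nat_dvd_iff of_nat_power)
    then have "[(int u)\<^sup>2 = - (int v)\<^sup>2] (mod int p)" by (simp add: cong_iff_dvd_diff)
    then have "[((int u)\<^sup>2) ^ (2 * k + 1) = (- (int v)\<^sup>2) ^ (2 * k + 1)] (mod int p)"
      by (rule cong_pow)
    \<comment> \<open>Since \<open>p = 4 * k + 3\<close>, half of \<open>p - 1\<close> is odd, so
      the minus sign survives the power.\<close>
    moreover have e: "p - 1 = 2 * (2 * k + 1)" using k by simp
    have "((int u)\<^sup>2) ^ (2 * k + 1) = int u ^ (p - 1)"
      by (simp only: e power_mult)
    moreover have "(- (int v)\<^sup>2) ^ (2 * k + 1) = - (int v ^ (p - 1))"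
      by (simp only: e power_mult power_minus_odd even_mult_iff even_add) simp
    ultimately have "[int u ^ (p - 1) = - (int v ^ (p - 1))] (mod int p)" by simp
    then have "[1 = - (1::int)] (mod int p)"
      using f by (meson cong_minus_minus_iff cong_sym cong_trans)
    then have "int p dvd 2" by (simp add: cong_iff_dvd_diff)
    then show False using k zdvd_imp_le[of "int p" 2] by auto
  qed
  then show "p dvd u" "p dvd v" by auto
qed

text \<open>For arguments up to \<open>p div 2\<close>, the squares and the differences of
  \<open>K\<close> with squares each take \<open>(p + 1) / 2\<close> distinct values. Together these
  exceed the \<open>p\<close> residues, so a square equals such a difference.\<close>

lemma exists_sum_two_squares_cong:
  fixes K :: nat
  assumes p: "prime p" "odd p"
  obtains u v where "u < p" "v < p" "[u\<^sup>2 + v\<^sup>2 = K] (mod p)"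
proof -
  define f where "f u = (int u)\<^sup>2 mod int p" for u :: nat
  define g where "g u = (int K - (int u)\<^sup>2) mod int p" for u :: nat
  have p0: "p > 0" using p prime_gt_0_nat by blast
  \<comment> \<open>As \<open>p\<close> is odd, \<open>u + v\<close> is at most
    \<open>p - 1\<close>; whichever factor of the difference of squares \<open>p\<close> divides
    must therefore vanish.\<close>
  have inj: "u = v" if "u \<le> p div 2" "v \<le> p div 2" "int p dvd (int u)\<^sup>2 - (int v)\<^sup>2" for u v
  proof -
    have uv: "u + v < p"
      using that(1,2) p(2) by (elim oddE) auto
    have "int p dvd (int u - int v) * (int u + int v)"
      using that(3) by (simp add: power2_eq_square algebra_simps)
    then consider "int p dvd int u - int v" | "int p dvd int u + int v"
      using p(1) prime_dvd_multD[of "int p"] by auto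
    then show ?thesis
    proof cases
      case 1
      then have "int u - int v = 0" using int_dvd_small_eq_0[OF 1] uv by linarith
      then show ?thesis by simp
    next
      case 2
      then have "int u + int v = 0" using int_dvd_small_eq_0[OF 2] uv by linarith
      then show ?thesis by simp
    qed
  qed
  have "inj_on f {..p div 2}"
    by (intro inj_onI inj) (auto simp: f_def mod_eq_dvd_iff)
  moreover have "inj_on g {..p div 2}"
  proof (intro inj_onI)
    fix u v assume "u \<in> {..p div 2}" "v \<in> {..p div 2}" "g u = g v"
    then have "v = u" by (intro inj) (auto simp: g_def mod_eq_dvd_iff)
    then show "u = v" ..
  qed
  ultimately have "card (f ` {..p div 2}) = p div 2 + 1" "card (g ` {..p div 2}) = p div 2 + 1"
    by (simp_all add: card_image)
  then have c: "card {0..<int p} < card (f ` {..p div 2}) + card (g ` {..p div 2})"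
    using p(2) by (elim oddE) auto
  obtain u v where uv: "u \<in> {..p div 2}" "v \<in> {..p div 2}" "f u = g v"
    by (rule images_intersect[OF _ _ _ c]) (use p0 in \<open>auto simp: f_def g_def\<close>)
  have lt: "u < p" "v < p" using uv p0 p(2) by (auto elim!: oddE)
  have "[(int u)\<^sup>2 = int K - (int v)\<^sup>2] (mod int p)"
    using uv(3) by (simp add: f_def g_def cong_def)
  then have "[(int u)\<^sup>2 + (int v)\<^sup>2 = int K] (mod int p)"
    by (simp add: cong_iff_dvd_diff algebra_simps)
  then have "[u\<^sup>2 + v\<^sup>2 = K] (mod p)"
    by (metis cong_int_iff of_nat_add of_nat_power)
  then show thesis using that lt by blast
qed

section \<open>Points of the plane and their quadrance\<close>

text \<open>Reduction modulo \<open>p\<close> makes the value itself the index of a state, so the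
  circles are the fibres of this map on \<open>plane p\<close>.\<close>

definition quadrance :: "nat \<Rightarrow> nat \<times> nat \<Rightarrow> nat" where
  "quadrance p a = ((fst a)\<^sup>2 + (snd a)\<^sup>2) mod p"

abbreviation plane :: "nat \<Rightarrow> (nat \<times> nat) set" where
  "plane p \<equiv> {..<p} \<times> {..<p}"

lemma mem_circle_iff:
  assumes "K < p"
  shows "a \<in> circle p K \<longleftrightarrow> a \<in> plane p \<and> quadrance p a = K"
  using assms by (cases a) (auto simp: circle_def quadrance_def cong_def)

lemma circle_subset_plane: "circle p K \<subseteq> plane p"
  by (auto simp: circle_def)

lemma finite_circle [simp]: "finite (circle p K)"
  by (rule finite_subset[OF circle_subset_plane]) simp

text \<open>Passing to integers makes subtraction available for the algebra with dot and cross
  products.\<close>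

lemma circle_int_dvd_iff:
  "(u, v) \<in> circle p K \<longleftrightarrow> u < p \<and> v < p \<and> int p dvd (int u)\<^sup>2 + (int v)\<^sup>2 - int K"
  by (auto simp: circle_def simp flip: cong_int_iff cong_iff_dvd_diff)

lemma add_pt_in_plane: "p > 0 \<Longrightarrow> add_pt p a b \<in> plane p"
  by (simp add: add_pt_def)

lemma quadrance_less: "p > 0 \<Longrightarrow> quadrance p a < p"
  by (simp add: quadrance_def)

lemma add_pt_inj:
  assumes "a \<in> plane p" "b \<in> plane p" "add_pt p a c = add_pt p b c"
  shows "a = b"
proof -
  have "[fst a + fst c = fst b + fst c] (mod p)" "[snd a + snd c = snd b + snd c] (mod p)"
    using assms(3) by (auto simp: add_pt_def cong_def)
  then have "[fst a = fst b] (mod p)" "[snd a = snd b] (mod p)"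
    by (auto simp: cong_add_rcancel_nat)
  then show ?thesis using assms(1,2) by (auto simp: prod_eq_iff cong_less_modulus_unique_nat)
qed

lemma add_pt_commute: "add_pt p a b = add_pt p b a"
  by (simp add: add_pt_def add.commute)

lemma nat_eq_if_int_dvd_diff:
  assumes "a < p" "b < p" "int p dvd int a - int b"
  shows "a = b"
  using int_dvd_small_eq_0[OF assms(3)] assms(1,2) by linarith

lemma quadrance_add_pt:
  "[int (quadrance p (add_pt p (u, v) (x, y))) =
     (int u)\<^sup>2 + (int v)\<^sup>2 + ((int x)\<^sup>2 + (int y)\<^sup>2) + 2 * (int u * int x + int v * int y)] (mod int p)"
proof -
  have "[((u + x) mod p)\<^sup>2 + ((v + y) mod p)\<^sup>2 = (u + x)\<^sup>2 + (v + y)\<^sup>2] (mod p)"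
    by (intro cong_add cong_pow) (auto simp: cong_def)
  then have "[quadrance p (add_pt p (u, v) (x, y)) = (u + x)\<^sup>2 + (v + y)\<^sup>2] (mod p)"
    by (simp add: quadrance_def add_pt_def cong_def)
  then have "[int (quadrance p (add_pt p (u, v) (x, y))) = int ((u + x)\<^sup>2 + (v + y)\<^sup>2)] (mod int p)"
    by (simp only: cong_int_iff)
  also have "int ((u + x)\<^sup>2 + (v + y)\<^sup>2) =
     (int u)\<^sup>2 + (int v)\<^sup>2 + ((int x)\<^sup>2 + (int y)\<^sup>2) + 2 * (int u * int x + int v * int y)"
    by (simp add: power2_eq_square algebra_simps)
  finally show ?thesis .
qed

text \<open>Multiplication by the Gaussian integer \<open>a + bi\<close> multiplies quadrances by \<open>a\<^sup>2 + b\<^sup>2\<close>.\<close>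

lemma card_circle_le:
  assumes p: "prime p" and n: "\<not> int p dvd (int a)\<^sup>2 + (int b)\<^sup>2"
    and KL: "int p dvd int K * ((int a)\<^sup>2 + (int b)\<^sup>2) - int L"
  shows "card (circle p K) \<le> card (circle p L)"
proof -
  define f where "f = (\<lambda>(u, v). (nat ((int a * int u - int b * int v) mod int p),
                                 nat ((int a * int v + int b * int u) mod int p)))"
  have p0: "int p > 0" using p prime_gt_0_nat by simp
  have "inj_on f (circle p K)"
  proof (intro inj_onI)
    fix c c' assume c: "c \<in> circle p K" "c' \<in> circle p K" and e: "f c = f c'"
    obtain u v where uv: "c = (u, v)" by (cases c)
    obtain u' v' where uv': "c' = (u', v')" by (cases c')
    define d where "d = int u - int u'"
    define e where "e = int v - int v'"
    have "(int a * int u - int b * int v) mod int p = (int a * int u' - int b * int v') mod int p"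
      "(int a * int v + int b * int u) mod int p = (int a * int v' + int b * int u') mod int p"
      using \<open>f c = f c'\<close> p0 by (auto simp: f_def uv uv' nat_eq_iff)
    then have "int p dvd int a * d - int b * e" "int p dvd int a * e + int b * d"
      by (auto simp: mod_eq_dvd_iff d_def e_def algebra_simps)
    \<comment> \<open>Multiplying by the conjugate \<open>a - bi\<close> leaves the norm
      \<open>a\<^sup>2 + b\<^sup>2\<close> times \<open>d\<close> and times \<open>e\<close>; the
      norm is a unit modulo \<open>p\<close>.\<close>
    then have "int p dvd int a * (int a * d - int b * e) + int b * (int a * e + int b * d)"
      "int p dvd int a * (int a * e + int b * d) - int b * (int a * d - int b * e)"
      by (meson dvd_add dvd_diff dvd_mult)+
    moreover have "int a * (int a * d - int b * e) + int b * (int a * e + int b * d)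
        = ((int a)\<^sup>2 + (int b)\<^sup>2) * d"
      "int a * (int a * e + int b * d) - int b * (int a * d - int b * e)
        = ((int a)\<^sup>2 + (int b)\<^sup>2) * e"
      by (auto simp: algebra_simps power2_eq_square)
    ultimately have "int p dvd d" "int p dvd e"
      using n p prime_dvd_multD[of "int p"] by auto
    then show "c = c'"
      using c nat_eq_if_int_dvd_diff by (auto simp: uv uv' d_def e_def circle_def)
  qed
  moreover have "f ` circle p K \<subseteq> circle p L"
  proof (rule image_subsetI)
    fix c assume c: "c \<in> circle p K"
    obtain u v where c_eq: "c = (u, v)" by (cases c)
    then have uv: "(u, v) \<in> circle p K" using c by simp
    let ?x = "int a * int u - int b * int v" and ?y = "int a * int v + int b * int u"
    have "[(?x mod int p)\<^sup>2 + (?y mod int p)\<^sup>2 = ?x\<^sup>2 + ?y\<^sup>2] (mod int p)"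
      by (intro cong_add cong_pow) (auto simp: cong_def)
    also have "?x\<^sup>2 + ?y\<^sup>2 = ((int u)\<^sup>2 + (int v)\<^sup>2) * ((int a)\<^sup>2 + (int b)\<^sup>2)"
      by (simp add: algebra_simps power2_eq_square)
    also have "[\<dots> = int K * ((int a)\<^sup>2 + (int b)\<^sup>2)] (mod int p)"
      using uv by (intro cong_mult) (auto simp: circle_int_dvd_iff cong_iff_dvd_diff)
    also have "[int K * ((int a)\<^sup>2 + (int b)\<^sup>2) = int L] (mod int p)"
      using KL by (simp add: cong_iff_dvd_diff)
    finally have "int p dvd (?x mod int p)\<^sup>2 + (?y mod int p)\<^sup>2 - int L"
      by (simp add: cong_iff_dvd_diff)
    then show "f c \<in> circle p L"
      using p0 unfolding c_eq by (simp add: f_def circle_int_dvd_iff nat_less_iff)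
  qed
  ultimately show ?thesis by (intro card_inj_on_le) auto
qed

section \<open>Sizes of the circles for a prime congruent to 3 modulo 4\<close>

context
  fixes p :: nat
  assumes p: "prime p" "[p = 3] (mod 4)"
begin

lemma p_bounds: "odd p" "p \<ge> 3"
proof -
  have "p mod 4 = 3" using p(2) by (simp add: cong_def)
  then have "p = 4 * (p div 4) + 3" by (metis mult_div_mod_eq)
  then show "odd p" "p \<ge> 3" by presburger+
qed

lemma circle_0: "circle p 0 = {(0, 0)}"
proof -
  have "u = 0 \<and> v = 0" if "(u, v) \<in> circle p 0" for u v
  proof -
    have "p dvd u\<^sup>2 + v\<^sup>2" using that by (simp add: circle_def cong_0_iff)
    from prime_3_mod_4_anisotropic[OF p this] that show ?thesis
      by (auto simp: circle_def dest: nat_dvd_not_less)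
  qed
  moreover have "(0, 0) \<in> circle p 0" using p_bounds by (simp add: circle_def)
  ultimately show ?thesis by auto
qed

text \<open>Every residue is the norm of a Gaussian integer. Multiplication by one of norm
  \<open>1 / K\<close> injects \<open>C_K\<close> into \<open>C_1\<close>, and by one of norm
  \<open>K\<close> injects \<open>C_1\<close> into \<open>C_K\<close>.\<close>

lemma card_circle_eq_card_unit_circle:
  assumes "0 < K" "K < p"
  shows "card (circle p K) = card (circle p 1)"
proof (rule antisym)
  have "coprime K p" using assms p(1)
    by (metis coprime_commute nat_dvd_not_less prime_imp_coprime)
  then obtain L where L: "[K * L = 1] (mod p)"
    using cong_solve_coprime_nat[of K p] by auto
  obtain a b where ab: "[a\<^sup>2 + b\<^sup>2 = L] (mod p)"
    using exists_sum_two_squares_cong[OF p(1) p_bounds(1)] by metis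
  have "[K * (a\<^sup>2 + b\<^sup>2) = 1] (mod p)"
    using cong_scalar_left[OF ab] L cong_trans by blast
  then have "[int (K * (a\<^sup>2 + b\<^sup>2)) = int 1] (mod int p)" by (simp only: cong_int_iff)
  then have d: "int p dvd int K * ((int a)\<^sup>2 + (int b)\<^sup>2) - int 1" by (simp add: cong_iff_dvd_diff)
  moreover have "\<not> int p dvd (int a)\<^sup>2 + (int b)\<^sup>2"
  proof
    assume "int p dvd (int a)\<^sup>2 + (int b)\<^sup>2"
    then have "int p dvd int 1"
      using d by (metis dvd_diff_right_iff dvd_mult dvd_diff_commute dvd_trans)
    then show False using p_bounds(2) by simp
  qed
  ultimately show "card (circle p K) \<le> card (circle p 1)"
    using card_circle_le[OF p(1)] by blast
next
  obtain a b where ab: "[a\<^sup>2 + b\<^sup>2 = K] (mod p)"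
    using exists_sum_two_squares_cong[OF p(1) p_bounds(1)] by metis
  then have "[int (a\<^sup>2 + b\<^sup>2) = int K] (mod int p)" by (simp only: cong_int_iff)
  then have "int p dvd int 1 * ((int a)\<^sup>2 + (int b)\<^sup>2) - int K" by (simp add: cong_iff_dvd_diff)
  moreover have "\<not> int p dvd (int a)\<^sup>2 + (int b)\<^sup>2"
  proof
    assume "int p dvd (int a)\<^sup>2 + (int b)\<^sup>2"
    then have "p dvd a\<^sup>2 + b\<^sup>2" by (metis of_nat_add of_nat_dvd_iff of_nat_power)
    then have "p dvd K" using ab cong_dvd_iff by (metis cong_0_iff cong_sym cong_trans)
    then show False using assms by (auto dest: nat_dvd_not_less)
  qed
  ultimately show "card (circle p 1) \<le> card (circle p K)"
    using card_circle_le[OF p(1)] by blast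
qed

lemma sum_over_circles: "(\<Sum>K<p. \<Sum>a\<in>circle p K. h a) = (\<Sum>a\<in>plane p. h a)"
  for h :: "nat \<times> nat \<Rightarrow> 'a :: comm_monoid_add"
proof -
  have "(\<Sum>a\<in>plane p. h a) = (\<Sum>K<p. \<Sum>a\<in>{a \<in> plane p. quadrance p a = K}. h a)"
    by (rule sum.group[symmetric]) (use p_bounds in \<open>auto intro: quadrance_less\<close>)
  also have "\<dots> = (\<Sum>K<p. \<Sum>a\<in>circle p K. h a)"
    by (intro sum.cong) (auto simp: mem_circle_iff)
  finally show ?thesis ..
qed

text \<open>The circles partition the plane: the origin and \<open>p - 1\<close> circles of equal
  size account for \<open>p * p\<close> points.\<close>

lemma card_circle:
  assumes "0 < K" "K < p"
  shows "card (circle p K) = p + 1"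
proof -
  have "p * p = (\<Sum>K<p. card (circle p K))"
    using sum_over_circles[of "\<lambda>_. 1::nat"] by simp
  also have "\<dots> = card (circle p 0) + (\<Sum>K\<in>{..<p} - {0}. card (circle p K))"
    using p_bounds by (intro sum.remove) auto
  also have "(\<Sum>K\<in>{..<p} - {0}. card (circle p K)) = (\<Sum>K\<in>{..<p} - {0}. card (circle p 1))"
    by (intro sum.cong refl card_circle_eq_card_unit_circle) auto
  also have "\<dots> = (p - 1) * card (circle p 1)" using p_bounds by simp
  finally have "p * p = 1 + (p - 1) * card (circle p 1)" by (simp add: circle_0)
  moreover have "p * p = 1 + (p - 1) * (p + 1)" using p_bounds
    by (cases p) auto
  ultimately have "(p - 1) * card (circle p 1) = (p - 1) * (p + 1)" by linarith
  then have "p - 1 = 0 \<or> card (circle p 1) = p + 1" by (simp only: mult_cancel_left)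
  then have "card (circle p 1) = p + 1" using p_bounds by auto
  then show ?thesis using card_circle_eq_card_unit_circle[OF assms] by simp
qed

text \<open>The stationary distribution is the image of the uniform distribution on the plane under
  \<open>quadrance\<close>.\<close>

lemma circle_stationary_eq: "j < p \<Longrightarrow> circle_stationary p j = card (circle p j) / (real p)\<^sup>2"
  using card_circle[of j] by (cases "j = 0") (auto simp: circle_stationary_def circle_0)

text \<open>
  A point \<open>b\<close> of the unit circle with given \<open>q (a + b)\<close> has a given inner product with \<open>a\<close>, hence,
  by \<open>(a \<cdot> b)\<^sup>2 + (a \<times> b)\<^sup>2 = q a * q b\<close>, a cross product with \<open>a\<close> determined up to sign.
\<close>

lemma card_image_quadrance:
  assumes a: "a \<in> plane p" "a \<noteq> (0, 0)"
  shows "p + 1 \<le> 2 * card ((\<lambda>b. quadrance p (add_pt p a b)) ` circle p 1)"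
proof -
  obtain u v where uv: "a = (u, v)" by (cases a)
  let ?q = "\<lambda>b. quadrance p (add_pt p a b)"
  define cr where "cr = (\<lambda>(x, y). (int u * int y - int v * int x) mod int p)"
  have n: "\<not> int p dvd (int u)\<^sup>2 + (int v)\<^sup>2"
  proof
    assume "int p dvd (int u)\<^sup>2 + (int v)\<^sup>2"
    then have "p dvd u\<^sup>2 + v\<^sup>2" by (metis of_nat_add of_nat_dvd_iff of_nat_power)
    from prime_3_mod_4_anisotropic[OF p this] show False
      using a uv by (auto dest: nat_dvd_not_less)
  qed
  have p': "prime (int p)" using p by simp
  have dot: "int p dvd (int u * int x + int v * int y) - (int u * int x' + int v * int y')"
    if "(x, y) \<in> circle p 1" "(x', y') \<in> circle p 1" "?q (x, y) = ?q (x', y')" for x y x' y'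
  proof -
    let ?U = "(int u)\<^sup>2 + (int v)\<^sup>2"
    have e: "quadrance p (add_pt p (u, v) (x, y)) = quadrance p (add_pt p (u, v) (x', y'))"
      using that(3) uv by simp
    have "[?U + ((int x)\<^sup>2 + (int y)\<^sup>2) + 2 * (int u * int x + int v * int y)
        = ?U + ((int x')\<^sup>2 + (int y')\<^sup>2) + 2 * (int u * int x' + int v * int y')] (mod int p)"
      by (rule cong_trans[OF cong_sym[OF quadrance_add_pt[of p u v x y, unfolded e]]
            quadrance_add_pt])
    then have 1: "int p dvd ?U + ((int x)\<^sup>2 + (int y)\<^sup>2) + 2 * (int u * int x + int v * int y)
        - (?U + ((int x')\<^sup>2 + (int y')\<^sup>2) + 2 * (int u * int x' + int v * int y'))"
      by (simp only: cong_iff_dvd_diff)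
    have 2: "int p dvd ((int x)\<^sup>2 + (int y)\<^sup>2) - 1" "int p dvd ((int x')\<^sup>2 + (int y')\<^sup>2) - 1"
      using that by (auto simp: circle_int_dvd_iff)
    \<comment> \<open>Subtracting the conditions that both points lie on the unit circle leaves
      twice the difference of the inner products, and 2 is a unit.\<close>
    have "int p dvd
       (?U + ((int x)\<^sup>2 + (int y)\<^sup>2) + 2 * (int u * int x + int v * int y)
        - (?U + ((int x')\<^sup>2 + (int y')\<^sup>2) + 2 * (int u * int x' + int v * int y')))
       - ((((int x)\<^sup>2 + (int y)\<^sup>2) - 1) - (((int x')\<^sup>2 + (int y')\<^sup>2) - 1))"
      by (rule dvd_diff[OF 1 dvd_diff[OF 2]])
    also have "\<dots> = 2 * ((int u * int x + int v * int y) - (int u * int x' + int v * int y'))"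
      by (simp add: algebra_simps)
    finally have "int p dvd 2 \<or>
        int p dvd (int u * int x + int v * int y) - (int u * int x' + int v * int y')"
      using prime_dvd_multD[OF p'] by blast
    moreover have "\<not> int p dvd 2" using p_bounds zdvd_imp_le[of "int p" 2] by auto
    ultimately show ?thesis by blast
  qed
  have "card {b \<in> circle p 1. ?q b = y} \<le> 2" if "y \<in> ?q ` circle p 1" for y
  proof -
    obtain b where b: "b \<in> circle p 1" "?q b = y" using \<open>y \<in> _\<close> by auto
    obtain x\<^sub>0 y\<^sub>0 where xy0: "b = (x\<^sub>0, y\<^sub>0)" by (cases b)
    let ?F = "{b \<in> circle p 1. ?q b = y}"
    let ?w = "int u * int y\<^sub>0 - int v * int x\<^sub>0"
    \<comment> \<open>Inner and cross product with \<open>a\<close> form a linear system of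
      determinant \<open>u\<^sup>2 + v\<^sup>2\<close>, a unit, and on \<open>?F\<close> the inner
      product is constant.\<close>
    have "inj_on cr ?F"
    proof (intro inj_onI)
      fix c c' assume c: "c \<in> ?F" "c' \<in> ?F" "cr c = cr c'"
      obtain x y where xy: "c = (x, y)" by (cases c)
      obtain x' y' where xy': "c' = (x', y')" by (cases c')
      define d where "d = int x - int x'"
      define e where "e = int y - int y'"
      have "int p dvd int u * d + int v * e"
        using dot[of x y x' y'] c by (auto simp: xy xy' d_def e_def algebra_simps)
      moreover have "int p dvd int u * e - int v * d"
        using c(3) by (auto simp: xy xy' d_def e_def cr_def mod_eq_dvd_iff algebra_simps)
      ultimately have
        "int p dvd int u * (int u * d + int v * e) - int v * (int u * e - int v * d)"
        "int p dvd int v * (int u * d + int v * e) + int u * (int u * e - int v * d)"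
        by (meson dvd_add dvd_diff dvd_mult)+
      moreover have "int u * (int u * d + int v * e) - int v * (int u * e - int v * d)
          = ((int u)\<^sup>2 + (int v)\<^sup>2) * d"
        "int v * (int u * d + int v * e) + int u * (int u * e - int v * d)
          = ((int u)\<^sup>2 + (int v)\<^sup>2) * e"
        by (auto simp: algebra_simps power2_eq_square)
      ultimately have "int p dvd d" "int p dvd e"
        using n prime_dvd_multD[OF p'] by auto
      then show "c = c'"
        using c nat_eq_if_int_dvd_diff by (auto simp: xy xy' d_def e_def circle_def)
    qed
    moreover have "cr ` ?F \<subseteq> {?w mod int p, (- ?w) mod int p}"
    proof
      fix z assume "z \<in> cr ` ?F"
      then obtain x y' where xy: "(x, y') \<in> ?F" "z = cr (x, y')" by auto
      let ?w' = "int u * int y' - int v * int x"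
      let ?s = "int u * int x + int v * int y'" and ?s\<^sub>0 = "int u * int x\<^sub>0 + int v * int y\<^sub>0"
      let ?U = "(int u)\<^sup>2 + (int v)\<^sup>2"
      have "int p dvd ?s - ?s\<^sub>0"
        using dot[of x y' x\<^sub>0 y\<^sub>0] xy(1) b xy0 by auto
      moreover have "int p dvd ((int x)\<^sup>2 + (int y')\<^sup>2) - 1" "int p dvd ((int x\<^sub>0)\<^sup>2 + (int y\<^sub>0)\<^sup>2) - 1"
        using xy(1) b xy0 by (auto simp: circle_int_dvd_iff)
      \<comment> \<open>Both points have quadrance 1 and congruent inner products with
        \<open>a\<close>, so the Lagrange identity makes the squares of their cross products
        congruent.\<close>
      ultimately have "int p dvd ?U * (((int x)\<^sup>2 + (int y')\<^sup>2) - 1)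
          - ?U * (((int x\<^sub>0)\<^sup>2 + (int y\<^sub>0)\<^sup>2) - 1) - (?s + ?s\<^sub>0) * (?s - ?s\<^sub>0)"
        by (meson dvd_diff dvd_mult)
      also have "\<dots> = (?w' - ?w) * (?w' + ?w)"
        by (simp add: algebra_simps power2_eq_square)
      finally have "int p dvd ?w' - ?w \<or> int p dvd ?w' + ?w"
        using prime_dvd_multD[OF p'] by blast
      then have "?w' mod int p = ?w mod int p \<or> ?w' mod int p = (- ?w) mod int p"
        unfolding mod_eq_dvd_iff by (simp add: algebra_simps)
      then show "z \<in> {?w mod int p, (- ?w) mod int p}" using xy(2) by (simp add: cr_def)
    qed
    ultimately have "card ?F \<le> card {?w mod int p, (- ?w) mod int p}"
      by (intro card_inj_on_le) auto
    also have "\<dots> \<le> 2" by (simp add: card_insert_le_m1)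
    finally show ?thesis .
  qed
  then have "card (circle p 1) \<le> 2 * card (?q ` circle p 1)"
    by (intro card_le_mult_card_image) auto
  then show ?thesis using card_circle[of 1] p_bounds by simp
qed

section \<open>Contraction of the oscillation\<close>

lemma circle_N_eq_sum:
  "real (circle_N p i k j)
     = (\<Sum>a\<in>circle p i. \<Sum>b\<in>circle p k. of_bool (add_pt p a b \<in> circle p j))"
proof -
  have "(\<Sum>a\<in>circle p i. \<Sum>b\<in>circle p k. of_bool (add_pt p a b \<in> circle p j) :: real)
    = (\<Sum>ab\<in>circle p i \<times> circle p k. of_bool (add_pt p (fst ab) (snd ab) \<in> circle p j))"
    by (simp only: sum.cartesian_product split_def)
  also have "\<dots> = real (card ((circle p i \<times> circle p k) \<inter>
      {ab. add_pt p (fst ab) (snd ab) \<in> circle p j}))"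
    by (subst sum_of_bool_eq) auto
  also have "(circle p i \<times> circle p k) \<inter> {ab. add_pt p (fst ab) (snd ab) \<in> circle p j}
    = {(a, b) \<in> circle p i \<times> circle p k. add_pt p a b \<in> circle p j}"
    by auto
  finally show ?thesis by (simp add: circle_N_def)
qed

lemma circle_kernel_carrier: "circle_kernel p \<in> carrier_mat p p"
  by (simp add: circle_kernel_def)

text \<open>Each pair of a start \<open>a\<close> and a step \<open>b\<close> contributes to exactly
  one target state, so summing over targets first leaves a plain average over pairs.\<close>

lemma mat_app_circle_kernel:
  assumes "i < p"
  shows "mat_app (circle_kernel p) f i
    = (\<Sum>a\<in>circle p i. \<Sum>b\<in>circle p 1. f (quadrance p (add_pt p a b)))
        / (real (card (circle p i)) * (real p + 1))"
proof -
  have p0: "p > 0" using p_bounds by simp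
  have c1: "real (card (circle p 1)) = real p + 1" using card_circle[of 1] p_bounds by simp
  have "(\<Sum>j<p. real (circle_N p i 1 j) * f j)
    = (\<Sum>j<p. \<Sum>a\<in>circle p i. \<Sum>b\<in>circle p 1. of_bool (add_pt p a b \<in> circle p j) * f j)"
    by (simp add: circle_N_eq_sum sum_distrib_right)
  also have "\<dots> = (\<Sum>a\<in>circle p i. \<Sum>b\<in>circle p 1. \<Sum>j<p. of_bool (add_pt p a b \<in> circle p j) * f j)"
    by (subst sum.swap, intro sum.cong refl, rule sum.swap)
  also have "\<dots> = (\<Sum>a\<in>circle p i. \<Sum>b\<in>circle p 1. f (quadrance p (add_pt p a b)))"
  proof (intro sum.cong refl)
    fix a b
    have "(\<Sum>j<p. of_bool (add_pt p a b \<in> circle p j) * f j)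
      = (\<Sum>j<p. if quadrance p (add_pt p a b) = j then f j else 0)"
      using add_pt_in_plane[OF p0] by (intro sum.cong) (auto simp: mem_circle_iff)
    also have "\<dots> = f (quadrance p (add_pt p a b))"
      using quadrance_less[OF p0] by simp
    finally show "(\<Sum>j<p. of_bool (add_pt p a b \<in> circle p j) * f j)
      = f (quadrance p (add_pt p a b))" .
  qed
  finally show ?thesis
    using assms c1
    by (simp add: mat_app_def circle_kernel_def circle_n_def flip: sum_divide_distrib)
qed

lemma card_circle_pos: "i < p \<Longrightarrow> card (circle p i) > 0"
  using card_circle[of i] by (cases "i = 0") (auto simp: circle_0)

text \<open>The stationary weights cancel the circle sizes, which turns the sum into one over the
  whole plane. There each fixed step \<open>b\<close> is a translation and permutes the
  points.\<close>

lemma circle_stationary_invariant: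
  "(\<Sum>i<p. circle_stationary p i * mat_app (circle_kernel p) f i)
     = (\<Sum>i<p. circle_stationary p i * f i)"
proof -
  have p0: "p > 0" using p_bounds by simp
  let ?g = "\<lambda>a. f (quadrance p a)"
  let ?c = "(real p)\<^sup>2 * (real p + 1)"
  have c1: "real (card (circle p 1)) = real p + 1" using card_circle[of 1] p_bounds by simp
  have bij: "bij_betw (\<lambda>a. add_pt p a b) (plane p) (plane p)" for b
  proof (rule bij_betwI')
    fix y assume y: "y \<in> plane p"
    have inj: "inj_on (\<lambda>a. add_pt p a b) (plane p)"
      by (intro inj_onI) (rule add_pt_inj)
    have "(\<lambda>a. add_pt p a b) ` plane p = plane p"
      by (rule endo_inj_surj[OF _ _ inj]) (use p0 in \<open>auto simp: add_pt_def\<close>)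
    then show "\<exists>x\<in>plane p. y = add_pt p x b" using y by blast
  qed (use add_pt_inj add_pt_in_plane[OF p0] in blast)+
  have "(\<Sum>i<p. circle_stationary p i * mat_app (circle_kernel p) f i)
    = (\<Sum>i<p. (\<Sum>a\<in>circle p i. \<Sum>b\<in>circle p 1. ?g (add_pt p a b)) / ?c)"
  proof (intro sum.cong refl)
    fix i assume "i \<in> {..<p}"
    then show "circle_stationary p i * mat_app (circle_kernel p) f i
      = (\<Sum>a\<in>circle p i. \<Sum>b\<in>circle p 1. ?g (add_pt p a b)) / ?c"
      using card_circle_pos[of i] by (simp add: circle_stationary_eq mat_app_circle_kernel)
  qed
  also have "\<dots> = (\<Sum>a\<in>plane p. \<Sum>b\<in>circle p 1. ?g (add_pt p a b)) / ?c"
    by (simp add: sum_over_circles flip: sum_divide_distrib)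
  also have "(\<Sum>a\<in>plane p. \<Sum>b\<in>circle p 1. ?g (add_pt p a b))
    = (\<Sum>b\<in>circle p 1. \<Sum>a\<in>plane p. ?g (add_pt p a b))"
    by (rule sum.swap)
  also have "\<dots> = (\<Sum>b\<in>circle p 1. \<Sum>a\<in>plane p. ?g a)"
    using sum.reindex_bij_betw[OF bij, of ?g] by simp
  also have "\<dots> = (real p + 1) * (\<Sum>a\<in>plane p. ?g a)" using c1 by simp
  also have "\<dots> / ?c = (\<Sum>a\<in>plane p. ?g a) / (real p)\<^sup>2"
  proof -
    have "real p + 1 \<noteq> 0" by linarith
    then show ?thesis by (simp add: divide_simps)
  qed
  also have "\<dots> = (\<Sum>i<p. \<Sum>a\<in>circle p i. ?g a) / (real p)\<^sup>2"
    by (simp only: sum_over_circles)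
  also have "\<dots> = (\<Sum>i<p. circle_stationary p i * f i)"
    by (auto simp: sum_divide_distrib mem_circle_iff circle_stationary_eq intro!: sum.cong)
  finally show ?thesis .
qed

lemma sum_circle_stationary: "(\<Sum>i<p. circle_stationary p i) = 1"
proof -
  have "(\<Sum>i<p. circle_stationary p i) = (\<Sum>i<p. \<Sum>a\<in>circle p i. 1::real) / (real p)\<^sup>2"
    by (simp add: sum_divide_distrib circle_stationary_eq)
  also have "\<dots> = 1" using p_bounds by (simp only: sum_over_circles) (simp add: power2_eq_square)
  finally show ?thesis .
qed

section \<open>Contraction in one step and in two steps\<close>

text \<open>For any two nonzero starting points, one pair of summands can be made to cancel; the
  other \<open>p\<close> of the \<open>p + 1\<close> pairs differ by at most \<open>D\<close> each.
  Averaging over starting points keeps the bound.\<close>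

lemma step_contraction:
  assumes f: "\<And>i j. i < p \<Longrightarrow> j < p \<Longrightarrow> \<bar>f i - f j\<bar> \<le> D"
    and ij: "0 < i" "i < p" "0 < j" "j < p"
  shows "\<bar>mat_app (circle_kernel p) f i - mat_app (circle_kernel p) f j\<bar>
           \<le> real p / (real p + 1) * D"
proof -
  have p0: "p > 0" using p_bounds by simp
  let ?C = "circle p 1"
  let ?g = "\<lambda>a b. f (quadrance p (add_pt p a b))"
  have c1: "card ?C = p + 1" using card_circle[of 1] p_bounds by simp
  have *: "\<bar>(\<Sum>b\<in>?C. ?g a b) - (\<Sum>b\<in>?C. ?g a' b)\<bar> \<le> real p * D"
    if aa: "a \<in> circle p i" "a' \<in> circle p j" for a a'
  proof -
    have "a \<in> plane p" "a' \<in> plane p" "a \<noteq> (0,0)" "a' \<noteq> (0,0)"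
      using aa ij by (auto simp: mem_circle_iff quadrance_def)
    \<comment> \<open>Each image has at least \<open>(p + 1) / 2\<close> elements, so the two
      together exceed the \<open>p\<close> states.\<close>
    from card_image_quadrance[OF this(1,3)] card_image_quadrance[OF this(2,4)]
    have c: "card {..<p} < card ((\<lambda>b. quadrance p (add_pt p a b)) ` ?C)
        + card ((\<lambda>b. quadrance p (add_pt p a' b)) ` ?C)" by simp
    obtain b b' where b: "b \<in> ?C" "b' \<in> ?C"
      "quadrance p (add_pt p a b) = quadrance p (add_pt p a' b')"
      by (rule images_intersect[OF _ _ _ c]) (use p0 in \<open>auto intro: quadrance_less\<close>)
    have "(\<Sum>b\<in>?C. ?g a b) - (\<Sum>b\<in>?C. ?g a' b)
        = (\<Sum>b\<in>?C - {b}. ?g a b) - (\<Sum>b\<in>?C - {b'}. ?g a' b)"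
      using sum.remove[OF finite_circle b(1), of "?g a"] sum.remove[OF finite_circle b(2), of "?g a'"]
        b(3) by simp
    also have "\<bar>\<dots>\<bar> \<le> real (card (?C - {b})) * D"
      by (rule abs_diff_sum_le) (use b p0 in \<open>auto intro!: f quadrance_less\<close>)
    also have "card (?C - {b}) = p" using b c1 by simp
    finally show ?thesis .
  qed
  have ci: "card (circle p i) = p + 1" "card (circle p j) = p + 1"
    using card_circle ij by auto
  have cr: "real (card (circle p i)) = real p + 1" "real (card (circle p j)) = real p + 1"
    using ci by simp_all
  let ?S = "\<lambda>i. \<Sum>a\<in>circle p i. \<Sum>b\<in>?C. ?g a b"
  have q: "real p + 1 \<noteq> 0" by linarith
  have "\<bar>?S i - ?S j\<bar> \<le> real (card (circle p i)) * (real p * D)"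
    by (rule abs_diff_sum_le) (use ci * in auto)
  then have le: "\<bar>?S i - ?S j\<bar> \<le> (real p + 1) * (real p * D)"
    by (simp only: cr)
  have "mat_app (circle_kernel p) f i - mat_app (circle_kernel p) f j
      = (?S i - ?S j) / ((real p + 1) * (real p + 1))"
    by (simp only: mat_app_circle_kernel ij cr diff_divide_distrib)
  also have "\<bar>\<dots>\<bar> = \<bar>?S i - ?S j\<bar> / ((real p + 1) * (real p + 1))"
    by (simp add: abs_divide abs_mult)
  also have "\<dots> \<le> (real p + 1) * (real p * D) / ((real p + 1) * (real p + 1))"
    using le by (intro divide_right_mono) auto
  also have "\<dots> = real p / (real p + 1) * D" using q by simp
  finally show ?thesis .
qed

lemma mat_app_circle_kernel_0: "mat_app (circle_kernel p) f 0 = f 1"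
proof -
  have c1: "card (circle p 1) = p + 1" using card_circle[of 1] p_bounds by simp
  have "(\<Sum>b\<in>circle p 1. f (quadrance p (add_pt p (0, 0) b))) = (\<Sum>b\<in>circle p 1. f 1)"
  proof (intro sum.cong refl)
    fix b assume "b \<in> circle p 1"
    then show "f (quadrance p (add_pt p (0, 0) b)) = f 1"
      using p_bounds by (auto simp: mem_circle_iff add_pt_def)
  qed
  also have "\<dots> = (real p + 1) * f 1" using c1 by simp
  finally have "mat_app (circle_kernel p) f 0 = (real p + 1) * f 1 / (real p + 1)"
    using p_bounds by (simp add: mat_app_circle_kernel circle_0)
  moreover have "real p + 1 \<noteq> 0" by linarith
  ultimately show ?thesis by simp
qed

text \<open>From nonzero states the second averaging already contracts. From state 0 the walk is
  forced to state 1, and \<open>mat_app (circle_kernel p) f\<close> at 1 is compared with its values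
  at the states reached from \<open>i\<close>. Only reaching 0 gives no contraction there, which
  costs the extra \<open>1 / (real p + 1)\<^sup>2\<close>.\<close>

lemma two_step_contraction:
  fixes D :: real
  assumes f: "\<And>i j. i < p \<Longrightarrow> j < p \<Longrightarrow> \<bar>f i - f j\<bar> \<le> D"
    and ij: "i < p" "j < p"
  shows "\<bar>mat_app (circle_kernel p) (mat_app (circle_kernel p) f) i
        - mat_app (circle_kernel p) (mat_app (circle_kernel p) f) j\<bar>
           \<le> (1 - real p / (real p + 1)\<^sup>2) * D"
proof -
  let ?T = "mat_app (circle_kernel p)"
  let ?C = "circle p 1" and ?r = "1 - real p / (real p + 1)\<^sup>2"
  have p0: "p > 0" "1 < p" using p_bounds by auto
  have c1: "card ?C = p + 1" using card_circle[of 1] p_bounds by simp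
  have D: "D \<ge> 0" using f[of 0 0] p0 by simp
  have r: "?r = real p / (real p + 1) + 1 / (real p + 1)\<^sup>2"
  proof -
    define q where "q = real p + 1"
    have q: "q \<noteq> 0" and e: "real p = q - 1" by (auto simp: q_def)
    show ?thesis
      unfolding q_def[symmetric] unfolding e using q by (simp add: field_simps power2_eq_square)
  qed
  have step: "\<bar>?T g i - ?T g j\<bar> \<le> real p / (real p + 1) * D"
    if "\<forall>i<p. \<forall>j<p. \<bar>g i - g j\<bar> \<le> D" "0 < i" "i < p" "0 < j" "j < p" for g i j
    by (rule step_contraction) (use that in auto)
  have q: "real p + 1 \<noteq> 0" by linarith
  \<comment> \<open>The value at state 0 is the constant \<open>g 1\<close>, spread over the same
    pairs \<open>(a, b)\<close> that define the average at \<open>i\<close>.\<close>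
  have average: "?T g 0 - ?T g i
      = (\<Sum>a\<in>circle p i. \<Sum>b\<in>?C. g 1 - g (quadrance p (add_pt p a b))) / (real p + 1)\<^sup>2"
    if i: "0 < i" "i < p" for g i
  proof -
    let ?S = "\<Sum>a\<in>circle p i. \<Sum>b\<in>?C. g (quadrance p (add_pt p a b))"
    have cr: "real (card (circle p i)) = real p + 1" "real (card ?C) = real p + 1"
      using card_circle[OF i] c1 by simp_all
    have q: "(real p + 1)\<^sup>2 \<noteq> 0" by simp
    have "(\<Sum>a\<in>circle p i. \<Sum>b\<in>?C. g 1 - g (quadrance p (add_pt p a b)))
        = g 1 * (real p + 1)\<^sup>2 - ?S"
      by (simp only: sum_subtractf sum_constant cr power2_eq_square mult_ac)
    moreover have "?T g i = ?S / (real p + 1)\<^sup>2"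
      by (simp only: mat_app_circle_kernel i cr power2_eq_square)
    ultimately show ?thesis
      by (simp only: mat_app_circle_kernel_0 diff_divide_distrib nonzero_mult_div_cancel_right[OF q])
  qed
  have Tf0: "\<bar>?T f 0 - ?T f i\<bar> \<le> D" if "0 < i" "i < p" for i
  proof -
    have "\<bar>\<Sum>a\<in>circle p i. \<Sum>b\<in>?C. f 1 - f (quadrance p (add_pt p a b))\<bar>
        \<le> real (card (circle p i)) * (real (card ?C) * D)"
      by (intro abs_sum_le_card_mult f quadrance_less p0)
    also have "\<dots> = (real p + 1)\<^sup>2 * D"
      using card_circle[OF that] c1 by (simp add: power2_eq_square algebra_simps)
    finally show ?thesis
      unfolding average[OF that] by (simp add: abs_divide pos_divide_le_eq mult.commute)
  qed
  have Tf: "\<bar>?T f i - ?T f j\<bar> \<le> D" if "i < p" "j < p" for i j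
  proof -
    have "real p / (real p + 1) * D \<le> 1 * D" using D by (intro mult_right_mono) auto
    then have "\<bar>?T f i - ?T f j\<bar> \<le> D" if "0 < i" "0 < j"
      using step[of f i j] f that \<open>i < p\<close> \<open>j < p\<close> by fastforce
    then show ?thesis using Tf0[of i] Tf0[of j] that D
      by (cases "i = 0"; cases "j = 0") (auto simp: abs_minus_commute)
  qed
  have T2f0: "\<bar>?T (?T f) 0 - ?T (?T f) i\<bar> \<le> ?r * D" if i: "0 < i" "i < p" for i
  proof -
    let ?h = "\<lambda>a b. ?T f 1 - ?T f (quadrance p (add_pt p a b))"
    let ?e = "\<lambda>a b. of_bool (quadrance p (add_pt p a b) = 0) :: real"
    \<comment> \<open>Nonzero targets are covered by \<open>step\<close>. At target 0 only the bound
      \<open>D\<close> is available, split as \<open>p / (p + 1)\<close> and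
      \<open>1 / (p + 1)\<close> of \<open>D\<close>.\<close>
    have h: "\<bar>?h a b\<bar> \<le> real p / (real p + 1) * D + ?e a b * (D / (real p + 1))" for a b
    proof (cases "quadrance p (add_pt p a b) = 0")
      case True
      have "real p / (real p + 1) * D + D / (real p + 1) = (real p + 1) * D / (real p + 1)"
        by (simp only: add_divide_distrib distrib_right times_divide_eq_left mult_1_left)
      also have "\<dots> = D" using q by simp
      finally show ?thesis using True Tf[of 1 0] p0 by simp
    next
      case False
      then show ?thesis
        using f step[of f 1 "quadrance p (add_pt p a b)"] p0 quadrance_less[OF p0(1)]
        by simp
    qed
    \<comment> \<open>Quadrance 0 forces the origin, so at most one step \<open>b\<close>, the
      negative of \<open>a\<close>, leads there.\<close>
    have one: "(\<Sum>b\<in>?C. ?e a b) \<le> 1" for a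
    proof -
      have "b = b'" if "b \<in> ?C" "b' \<in> ?C" "quadrance p (add_pt p a b) = 0"
        "quadrance p (add_pt p a b') = 0" for b b'
      proof -
        have "add_pt p a b \<in> circle p 0" "add_pt p a b' \<in> circle p 0"
          using that add_pt_in_plane[OF p0(1)] p0 by (auto simp: mem_circle_iff)
        then have "add_pt p b a = add_pt p b' a" by (simp add: circle_0 add_pt_commute)
        then show ?thesis using add_pt_inj that circle_subset_plane by blast
      qed
      then have "card (?C \<inter> {b. quadrance p (add_pt p a b) = 0}) \<le> 1"
        by (auto simp: card_le_Suc0_iff_eq)
      then show ?thesis by (subst sum_of_bool_eq) auto
    qed
    have "\<bar>\<Sum>b\<in>?C. ?h a b\<bar> \<le> real p * D + D / (real p + 1)" for a
    proof -
      have "\<bar>\<Sum>b\<in>?C. ?h a b\<bar> \<le> (\<Sum>b\<in>?C. \<bar>?h a b\<bar>)" by (rule sum_abs)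
      also have "\<dots> \<le> (\<Sum>b\<in>?C. real p / (real p + 1) * D + ?e a b * (D / (real p + 1)))"
        by (intro sum_mono h)
      also have "\<dots> = real p * D + (\<Sum>b\<in>?C. ?e a b) * (D / (real p + 1))"
      proof -
        have "real (card ?C) * (real p / (real p + 1) * D) = real p * D"
          using q by (simp only: c1 of_nat_add of_nat_1) simp
        then show ?thesis
          by (simp only: sum.distrib sum_constant sum_distrib_right[symmetric])
      qed
      also have "\<dots> \<le> real p * D + 1 * (D / (real p + 1))"
        using one[of a] D by (intro add_left_mono mult_right_mono) auto
      finally show ?thesis by simp
    qed
    then have "\<bar>\<Sum>a\<in>circle p i. \<Sum>b\<in>?C. ?h a b\<bar>
        \<le> real (card (circle p i)) * (real p * D + D / (real p + 1))"
      by (intro abs_sum_le_card_mult)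
    also have "\<dots> = ?r * D * (real p + 1)\<^sup>2"
    proof -
      have "y * (x * D + D / y) = (x / y + 1 / y\<^sup>2) * D * y\<^sup>2" if "y \<noteq> 0" for x y :: real
        using that by (simp add: field_simps power2_eq_square)
      from this[OF q] show ?thesis
        unfolding r by (simp only: card_circle[OF i] of_nat_add of_nat_1)
    qed
    finally show ?thesis
      unfolding average[OF i] by (simp add: abs_divide pos_divide_le_eq)
  qed
  have "real p / (real p + 1) * D \<le> ?r * D"
    unfolding r using D by (intro mult_right_mono) auto
  moreover have "0 \<le> ?r * D" using D unfolding r by simp
  ultimately show ?thesis
    using T2f0[of i] T2f0[of j] step[of "?T f" i j] Tf ij
    by (cases "i = 0"; cases "j = 0") (auto simp: abs_minus_commute)
qed

section \<open>The mixing time bound\<close>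

text \<open>With \<open>r\<close> at most \<open>exp (- 1 / (2 * real p))\<close>,
  \<open>4 * p\<close> blocks of two steps bring the distance down to \<open>exp (- 2)\<close>,
  which is below the threshold since \<open>exp 1\<close> is at least 2.\<close>

lemma tv_dist_circle_kernel:
  assumes "i < p"
  shows "tv_dist {..<p} (\<lambda>j. (circle_kernel p ^\<^sub>m (2 * (4 * p))) $$ (i, j)) (circle_stationary p)
           \<le> 1 / (2 * exp 1)"
proof -
  let ?r = "1 - real p / (real p + 1)\<^sup>2"
  have p3: "real p \<ge> 3" using p_bounds by simp
  \<comment> \<open>This inequality uses \<open>p \<ge> 3\<close>; it fails for
    \<open>p = 2\<close>.\<close>
  have "(real p + 1)\<^sup>2 \<le> 2 * (real p)\<^sup>2"
  proof -
    have "3 * real p \<le> real p * real p" using p3 by (intro mult_right_mono) auto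
    moreover have "(real p + 1)\<^sup>2 = real p * real p + 2 * real p + 1"
      by (simp add: power2_eq_square algebra_simps)
    ultimately show ?thesis using p3 unfolding power2_eq_square[of "real p"] by linarith
  qed
  then have "1 / (2 * real p) \<le> real p / (real p + 1)\<^sup>2"
    using p3 by (simp add: field_simps power2_eq_square)
  then have "?r \<le> 1 + (- 1 / (2 * real p))" by simp
  also have "\<dots> \<le> exp (- 1 / (2 * real p))" by (rule exp_ge_add_one_self)
  finally have r: "?r \<le> exp (- 1 / (2 * real p))" .
  \<comment> \<open>Nonnegativity of the factor allows the bound on it to be raised to a
    power.\<close>
  have "real p \<le> (real p + 1)\<^sup>2" by (simp add: power2_eq_square algebra_simps)
  moreover have "0 < (real p + 1)\<^sup>2" by simp
  ultimately have r0: "0 \<le> ?r" by (simp only: diff_ge_0_iff_ge divide_le_eq_1_pos)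
  have "tv_dist {..<p} (\<lambda>j. (circle_kernel p ^\<^sub>m (2 * (4 * p))) $$ (i, j)) (circle_stationary p)
      \<le> ?r ^ (4 * p)"
    by (rule tv_dist_le_two_step_contraction[OF circle_kernel_carrier])
      (fact circle_stationary_invariant sum_circle_stationary two_step_contraction assms
        | simp add: circle_stationary_def)+
  also have "\<dots> \<le> exp (- 1 / (2 * real p)) ^ (4 * p)"
    using r r0 by (rule power_mono)
  also have "\<dots> = exp (- 2)" using p3 by (simp flip: exp_of_nat_mult)
  also have "\<dots> = 1 / (exp 1 * exp 1)" by (simp add: exp_minus divide_inverse flip: exp_add)
  also have "\<dots> \<le> 1 / (2 * exp 1)"
    using exp_ge_add_one_self[of 1] by (intro divide_left_mono mult_right_mono) auto
  finally show ?thesis .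
qed

text \<open>For every starting state the time \<open>8 * p\<close> belongs to the set whose infimum
  is taken, so each entry of the maximum is finite and bounded by it.\<close>

lemma circle_mixing_time_le: "circle_mixing_time p \<le> enat (8 * p)"
  unfolding circle_mixing_time_def
proof (rule Max.boundedI)
  show "x \<le> enat (8 * p)"
    if x: "x \<in> (\<lambda>i. INF t\<in>{t. tv_dist {..<p} (\<lambda>j. (circle_kernel p ^\<^sub>m t) $$ (i, j))
                  (circle_stationary p) \<le> 1 / (2 * exp 1)}. enat t) ` {..<p}" for x
  proof -
    have e: "2 * (4 * p) = 8 * p" by simp
    show ?thesis using x tv_dist_circle_kernel unfolding e by (auto intro!: INF_lower)
  qed
qed (use p_bounds in \<open>auto simp: lessThan_empty_iff bot_nat_def\<close>)

end

theorem theorem8: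
  shows "\<exists>C::real. \<forall>\<^sub>F p::nat in at_top. prime p \<and> [p = 3] (mod 4) \<longrightarrow>
           ereal_of_enat (circle_mixing_time p) \<le> ereal (C * real p)"
proof (intro exI always_eventually allI impI)
  \<comment> \<open>The witness for \<open>C\<close> is 8, and the bound is shown for every such
    prime.\<close>
  fix p :: nat assume "prime p \<and> [p = 3] (mod 4)"
  then have "ereal_of_enat (circle_mixing_time p) \<le> ereal_of_enat (enat (8 * p))"
    using circle_mixing_time_le by (simp only: ereal_of_enat_le_iff)
  then show "ereal_of_enat (circle_mixing_time p) \<le> ereal (8 * real p)" by simp
qed

end
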